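(* Consider the iterative downlink power control algorithm defined in the context, started from any feasible $\boldsymbol\kappa^0$. The objective $f(\boldsymbol\kappa,\boldsymbol\varpi_{\mathsf d})$ is bounded above (over feasible $\boldsymbol\kappa$ and $\varpi_{\mathsf d,n}\ge0$) and is monotonically non-decreasing after each iteration, i.e. $f(\boldsymbol\kappa^{i+1},\boldsymbol\varpi_{\mathsf d}^{i+1})\ge f(\boldsymbol\kappa^{i},\boldsymbol\varpi_{\mathsf d}^{i})$ for all $i\ge1$. Consequently the algorithm is convergent in the objective: the sequence $f(\boldsymbol\kappa^{i},\boldsymbol\varpi_{\mathsf d}^{i})$ converges.
   Context: **Data.** $\mathcal{U}_{\mathsf d}$ is a finite set of downlink users and $\mathcal{A}_{\mathsf d}$ a finite set of downlink APs. $\mathbf{f}_{jn}\in\mathbb{C}^N$ are random channels and $\mathbf{p}_{jq}\in\mathbb{C}^N$ random precoders, with $\mathbb{E}|\mathbf{f}_{jn}^T\mathbf{p}_{jq}|^2<\infty$. Let $\mathbf{g}_{\mathsf d,n}=(\mathbb{E}[\mathbf{f}_{jn}^T\mathbf{p}_{jn}])_{j\in\mathcal{A}_{\mathsf d}}$, assumed real-valued, and $[\mathbf{I}_{nq}]_{jj'}=\mathbb{E}[\mathbf{f}_{jn}^T\mathbf{p}_{jq}\mathbf{p}_{j'q}^H\mathbf{f}_{j'n}^*]$ for $j,j'\in\mathcal{A}_{\mathsf d}$. $\mathcal{E}_{\mathsf d}>0$ is the downlink power, and $\sigma^2_{\mathsf{eff.},\mathsf d,n}>0$ is the effective noise power,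 independent of $\boldsymbol\kappa$. The variables are $\boldsymbol\kappa=(\kappa_{jn})$, real, with $\boldsymbol\kappa_n=(\kappa_{jn})_{j\in\mathcal{A}_{\mathsf d}}$. Feasible means $\sum_{q\in\mathcal{U}_{\mathsf d}}\kappa_{jq}^2\le1$ for all $j\in\mathcal{A}_{\mathsf d}$. Put $$\mathsf{G}_{\mathsf d,n}(\boldsymbol\kappa)=(\boldsymbol\kappa_n^T\mathbf{g}_{\mathsf d,n})^2,\qquad \mathsf{I}_{\mathsf d,n}(\boldsymbol\kappa)=\sum_{q\in\mathcal{U}_{\mathsf d}}\boldsymbol\kappa_q^T\mathbf{I}_{nq}\boldsymbol\kappa_q-(\boldsymbol\kappa_n^T\mathbf{g}_{\mathsf d,n})^2+\tfrac{1}{\mathcal{E}_{\mathsf d}}\sigma^2_{\mathsf{eff.},\mathsf d,n}.$$ **Objective.** $$f(\boldsymbol\kappa,\boldsymbol\varpi_{\mathsf d})=\sum_{n\in\mathcal{U}_{\mathsf d}}\ln(1+\varpi_{\mathsf d,n})-\sum_{n\in\mathcal{U}_{\mathsf d}}\varpi_{\mathsf d,n}+\sum_{n\in\mathcal{U}_{\mathsf d}}\frac{(1+\varpi_{\mathsf d,n})\mathsf{G}_{\mathsf d,n}(\boldsymbol\kappa)}{\mathsf{G}_{\mathsf d,n}(\boldsymbol\kappa)+\mathsf{I}_{\mathsf d,n}(\boldsymbol\kappa)}.$$ **Algorithm.** Given $\boldsymbol\kappa^i$, perform for all $n\in\mathcal{U}_{\mathsf d}$: 1. $\varpi_{\mathsf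 d,n}^{i+1}=\mathsf{G}_{\mathsf d,n}(\boldsymbol\kappa^i)/\mathsf{I}_{\mathsf d,n}(\boldsymbol\kappa^i)$. 2. $\tilde\varpi_{\mathsf d,n}^{i+1}=\dfrac{\sqrt{1+\varpi_{\mathsf d,n}^{i+1}}\;\mathbf{g}_{\mathsf d,n}^T\boldsymbol\kappa_n^i}{\sum_{q\in\mathcal{U}_{\mathsf d}}(\boldsymbol\kappa_q^i)^T\mathbf{I}_{nq}\boldsymbol\kappa_q^i+\frac{1}{\mathcal{E}_{\mathsf d}}\sigma^2_{\mathsf{eff.},\mathsf d,n}}$. 3. $\boldsymbol\kappa^{i+1}$ is an optimal solution of the convex quadratically constrained quadratic program $$\max_{\boldsymbol\kappa}\ \sum_{n\in\mathcal{U}_{\mathsf d}}\Big(2\tilde\varpi_{\mathsf d,n}^{i+1}\sqrt{1+\varpi_{\mathsf d,n}^{i+1}}\,\boldsymbol\kappa_n^T\mathbf{g}_{\mathsf d,n}-(\tilde\varpi_{\mathsf d,n}^{i+1})^2\Big(\sum_{q\in\mathcal{U}_{\mathsf d}}\boldsymbol\kappa_q^T\mathbf{I}_{nq}\boldsymbol\kappa_q+\tfrac{1}{\mathcal{E}_{\mathsf d}}\sigma^2_{\mathsf{eff.},\mathsf d,n}\Big)\Big)\ \text{ s.t. }\ \sum_{q\in\mathcal{U}_{\mathsf d}}\kappa_{jq}^2\le1\ \ \forall j\in\mathcal{A}_{\mathsf d}$$ (in the paper this program is solved to optimality by ADMM). *)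

theory Defs
  imports "HOL-Probability.Probability"
begin

text \<open>
  The bilinear product \<open>x\<^sup>T y\<close> (no conjugation, unlike a Hermitian inner product) and the
  entrywise conjugate \<open>x\<^sup>*\<close>, so that \<open>x\<^sup>H y\<close> is \<open>dotT (cnj_vec x) y\<close>.
\<close>

definition dotT :: "complex ^ 'm::finite \<Rightarrow> complex ^ 'm \<Rightarrow> complex" where
  "dotT x y = (\<Sum>k\<in>UNIV. x $ k * y $ k)"

definition cnj_vec :: "complex ^ 'm::finite \<Rightarrow> complex ^ 'm" where
  "cnj_vec x = (\<chi> k. cnj (x $ k))"

lemma dotT_cnj_vec: "dotT (cnj_vec y) (cnj_vec x) = cnj (dotT x y)"
  by (simp add: dotT_def cnj_vec_def mult.commute)

text \<open>
  \<open>A\<close> and \<open>U\<close> are the downlink APs and users, \<open>f j n\<close> the channel between AP \<open>j\<close> and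
  user \<open>n\<close>, \<open>p j q\<close> the precoder of AP \<open>j\<close> for user \<open>q\<close>, \<open>Ed\<close> the downlink power and
  \<open>s2 n\<close> the effective noise power of user \<open>n\<close>. Power coefficients are functions
  \<open>\<kappa> j n\<close>, of which only the values for \<open>j \<in> A\<close> and \<open>n \<in> U\<close> matter.
\<close>

locale downlink_system = prob_space M for M :: "'w measure" +
  fixes A :: "'a set" and U :: "'u set"
    and f p :: "'a \<Rightarrow> 'u \<Rightarrow> 'w \<Rightarrow> complex ^ 'm::finite"
    and Ed :: real and s2 :: "'u \<Rightarrow> real"
  assumes finite_A: "finite A" and finite_U: "finite U"
    and f_measurable: "\<And>j n. j \<in> A \<Longrightarrow> n \<in> U \<Longrightarrow> f j n \<in> borel_measurable M"
    and p_measurable: "\<And>j q. j \<in> A \<Longrightarrow> q \<in> U \<Longrightarrow> p j q \<in> borel_measurable M"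
    and square_integrable: "\<And>j n q. j \<in> A \<Longrightarrow> n \<in> U \<Longrightarrow> q \<in> U \<Longrightarrow>
          integrable M (\<lambda>\<omega>. (cmod (dotT (f j n \<omega>) (p j q \<omega>)))\<^sup>2)"
    and mean_real: "\<And>j n. j \<in> A \<Longrightarrow> n \<in> U \<Longrightarrow>
          (\<integral>\<omega>. dotT (f j n \<omega>) (p j n \<omega>) \<partial>M) \<in> \<real>"
    and Ed_pos: "Ed > 0"
    and s2_pos: "\<And>n. n \<in> U \<Longrightarrow> s2 n > 0"
begin

text \<open>Taking the real part loses nothing here, by \<open>mean_real\<close>.\<close>

definition gvec :: "'u \<Rightarrow> 'a \<Rightarrow> real" where
  "gvec n j = Re (\<integral>\<omega>. dotT (f j n \<omega>) (p j n \<omega>) \<partial>M)"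

definition Imat :: "'u \<Rightarrow> 'u \<Rightarrow> 'a \<Rightarrow> 'a \<Rightarrow> complex" where
  "Imat n q j j' =
     (\<integral>\<omega>. dotT (f j n \<omega>) (p j q \<omega>) * dotT (cnj_vec (p j' q \<omega>)) (cnj_vec (f j' n \<omega>)) \<partial>M)"

definition lin :: "('a \<Rightarrow> 'u \<Rightarrow> real) \<Rightarrow> 'u \<Rightarrow> real" where
  "lin \<kappa> n = (\<Sum>j\<in>A. \<kappa> j n * gvec n j)"

text \<open>
  The matrix \<open>Imat n q\<close> is complex Hermitian, so its quadratic form at a real vector is a
  real number (\<open>quad_real\<close> below); \<open>Re\<close> only converts the type.
\<close>

definition quad :: "('a \<Rightarrow> 'u \<Rightarrow> real) \<Rightarrow> 'u \<Rightarrow> 'u \<Rightarrow> real" where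
  "quad \<kappa> n q =
     Re (\<Sum>j\<in>A. \<Sum>j'\<in>A. of_real (\<kappa> j q) * Imat n q j j' * of_real (\<kappa> j' q))"

lemma Imat_hermitian: "cnj (Imat n q j j') = Imat n q j' j"
  unfolding Imat_def dotT_cnj_vec
  by (subst Bochner_Integration.integral_cnj[symmetric]) (simp add: mult.commute)

lemma quad_real:
  "complex_of_real (quad \<kappa> n q) =
     (\<Sum>j\<in>A. \<Sum>j'\<in>A. of_real (\<kappa> j q) * Imat n q j j' * of_real (\<kappa> j' q))" (is "_ = ?S")
proof -
  have "cnj ?S = (\<Sum>j\<in>A. \<Sum>j'\<in>A. of_real (\<kappa> j' q) * Imat n q j' j * of_real (\<kappa> j q))"
    by (simp add: Imat_hermitian mult.commute mult.left_commute)
  also have "\<dots> = ?S"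
    by (rule sum.swap)
  finally have "?S \<in> \<real>"
    by (simp only: Reals_cnj_iff)
  then show ?thesis
    unfolding quad_def by (rule of_real_Re)
qed

definition total_power :: "('a \<Rightarrow> 'u \<Rightarrow> real) \<Rightarrow> 'u \<Rightarrow> real" where
  "total_power \<kappa> n = (\<Sum>q\<in>U. quad \<kappa> n q) + 1 / Ed * s2 n"

definition Gain :: "('a \<Rightarrow> 'u \<Rightarrow> real) \<Rightarrow> 'u \<Rightarrow> real" where
  "Gain \<kappa> n = (lin \<kappa> n)\<^sup>2"

definition Interf :: "('a \<Rightarrow> 'u \<Rightarrow> real) \<Rightarrow> 'u \<Rightarrow> real" where
  "Interf \<kappa> n = (\<Sum>q\<in>U. quad \<kappa> n q) - (lin \<kappa> n)\<^sup>2 + 1 / Ed * s2 n"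

definition feasible :: "('a \<Rightarrow> 'u \<Rightarrow> real) \<Rightarrow> bool" where
  "feasible \<kappa> \<longleftrightarrow> (\<forall>j\<in>A. (\<Sum>q\<in>U. (\<kappa> j q)\<^sup>2) \<le> 1)"

definition objective :: "('a \<Rightarrow> 'u \<Rightarrow> real) \<Rightarrow> ('u \<Rightarrow> real) \<Rightarrow> real" where
  "objective \<kappa> w =
     (\<Sum>n\<in>U. ln (1 + w n)) - (\<Sum>n\<in>U. w n)
     + (\<Sum>n\<in>U. (1 + w n) * Gain \<kappa> n / (Gain \<kappa> n + Interf \<kappa> n))"

definition qcqp_objective ::
    "('u \<Rightarrow> real) \<Rightarrow> ('u \<Rightarrow> real) \<Rightarrow> ('a \<Rightarrow> 'u \<Rightarrow> real) \<Rightarrow> real" where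
  "qcqp_objective w v \<kappa> =
     (\<Sum>n\<in>U. 2 * v n * sqrt (1 + w n) * lin \<kappa> n - (v n)\<^sup>2 * total_power \<kappa> n)"

text \<open>
  A run of the iteration from a feasible starting point; \<open>w\<close> and \<open>v\<close> are the auxiliary
  variables \<open>\<varpi>\<close> and its tilde version. The values \<open>w 0\<close> and \<open>v 0\<close> play no role and are
  unconstrained. The optimal solution chosen in the last step need not be unique.
\<close>

definition algorithm_run ::
    "(nat \<Rightarrow> 'a \<Rightarrow> 'u \<Rightarrow> real) \<Rightarrow> (nat \<Rightarrow> 'u \<Rightarrow> real) \<Rightarrow> (nat \<Rightarrow> 'u \<Rightarrow> real) \<Rightarrow> bool" where
  "algorithm_run \<kappa> w v \<longleftrightarrow>
     feasible (\<kappa> 0) \<and>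
     (\<forall>i. (\<forall>n\<in>U. w (Suc i) n = Gain (\<kappa> i) n / Interf (\<kappa> i) n) \<and>
          (\<forall>n\<in>U. v (Suc i) n = sqrt (1 + w (Suc i) n) * lin (\<kappa> i) n / total_power (\<kappa> i) n) \<and>
          is_arg_max (qcqp_objective (w (Suc i)) (v (Suc i))) feasible (\<kappa> (Suc i)))"

end

end

theory Submission
  imports Defs
begin

text \<open>
  With \<open>\<gamma> = Gain / Interf\<close>, the inequality \<open>ln x \<le> x - 1\<close> at \<open>x = (1 + w) / (1 + \<gamma>)\<close> shows that
  each summand of the objective is maximised over \<open>w\<close> at \<open>w = \<gamma>\<close>, with value \<open>ln (1 + \<gamma>)\<close>. Completing
  the square shows that each summand of the quadratic program is a lower bound
  \<open>2 v s l - v\<^sup>2 T \<le> (s l)\<^sup>2 / T\<close> of the corresponding fractional term, tight at the current iterate for the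
  chosen \<open>v\<close>. So the algorithm is a minorise-maximise scheme. It is well defined because
  \<open>quad \<kappa> n q\<close> is the second moment of the random variable whose mean (for \<open>q = n\<close>) has real part
  \<open>lin \<kappa> n\<close>, whence \<open>Interf \<ge> s2 / Ed > 0\<close>.
\<close>

section \<open>Measurability and second-moment bounds for complex random variables\<close>

lemma dotT_borel_measurable [measurable]:
  assumes [measurable]: "X \<in> borel_measurable M" "Y \<in> borel_measurable M"
  shows "(\<lambda>\<omega>. dotT (X \<omega>) (Y \<omega>)) \<in> borel_measurable M"
proof -
  have [measurable]: "(\<lambda>x. x $ k) \<in> borel_measurable (borel :: (complex ^ 'n) measure)" for k
    by (intro borel_measurable_continuous_onI continuous_intros)
  show ?thesis
    unfolding dotT_def by measurable
qed

text \<open>The product is dominated by the sum of the squared moduli, since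
  \<open>2 * x * y \<le> x\<^sup>2 + y\<^sup>2\<close>.\<close>

lemma integrable_mult_cnj:
  fixes X Y :: "'w \<Rightarrow> complex"
  assumes [measurable]: "X \<in> borel_measurable M" "Y \<in> borel_measurable M"
    and "integrable M (\<lambda>\<omega>. (cmod (X \<omega>))\<^sup>2)" "integrable M (\<lambda>\<omega>. (cmod (Y \<omega>))\<^sup>2)"
  shows "integrable M (\<lambda>\<omega>. X \<omega> * cnj (Y \<omega>))"
proof (rule Bochner_Integration.integrable_bound)
  show "integrable M (\<lambda>\<omega>. (cmod (X \<omega>))\<^sup>2 + (cmod (Y \<omega>))\<^sup>2)"
    using assms by simp
  show "AE \<omega> in M. norm (X \<omega> * cnj (Y \<omega>)) \<le> norm ((cmod (X \<omega>))\<^sup>2 + (cmod (Y \<omega>))\<^sup>2)"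
  proof (rule AE_I2)
    fix \<omega>
    have "2 * (cmod (X \<omega>) * cmod (Y \<omega>)) \<le> (cmod (X \<omega>))\<^sup>2 + (cmod (Y \<omega>))\<^sup>2"
      using sum_squares_bound[of "cmod (X \<omega>)" "cmod (Y \<omega>)"] by (simp add: mult.assoc)
    moreover have "0 \<le> cmod (X \<omega>) * cmod (Y \<omega>)"
      by simp
    ultimately show "norm (X \<omega> * cnj (Y \<omega>)) \<le> norm ((cmod (X \<omega>))\<^sup>2 + (cmod (Y \<omega>))\<^sup>2)"
      unfolding norm_mult complex_mod_cnj real_norm_def by linarith
  qed
  have [measurable]: "cnj \<in> borel_measurable borel"
    by (intro borel_measurable_continuous_onI continuous_intros)
  show "(\<lambda>\<omega>. X \<omega> * cnj (Y \<omega>)) \<in> borel_measurable M"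
    by measurable
qed

text \<open>Nonnegativity of the variance of \<open>Re Y\<close>, combined with
  \<open>(Re z)\<^sup>2 \<le> (cmod z)\<^sup>2\<close>.\<close>

lemma (in prob_space) mean_Re_square_le:
  fixes Y :: "'a \<Rightarrow> complex"
  assumes Y [measurable]: "Y \<in> borel_measurable M"
    and sq: "integrable M (\<lambda>\<omega>. (cmod (Y \<omega>))\<^sup>2)"
  shows "(Re (\<integral>\<omega>. Y \<omega> \<partial>M))\<^sup>2 \<le> (\<integral>\<omega>. (cmod (Y \<omega>))\<^sup>2 \<partial>M)"
proof -
  \<comment> \<open>With the constant 1 as second factor, square integrability gives integrability
    on a probability space.\<close>
  have int: "integrable M Y"
    using integrable_mult_cnj[OF Y _ sq, of "\<lambda>_. 1"] by simp
  have sq_Re: "integrable M (\<lambda>\<omega>. (Re (Y \<omega>))\<^sup>2)"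
    by (rule Bochner_Integration.integrable_bound[OF sq])
      (simp_all add: cmod_power2)
  have "0 \<le> variance (\<lambda>\<omega>. Re (Y \<omega>))"
    by (rule variance_positive)
  then have "(expectation (\<lambda>\<omega>. Re (Y \<omega>)))\<^sup>2 \<le> expectation (\<lambda>\<omega>. (Re (Y \<omega>))\<^sup>2)"
    unfolding variance_eq[OF integrable_Re[OF int] sq_Re] by simp
  also have "\<dots> \<le> expectation (\<lambda>\<omega>. (cmod (Y \<omega>))\<^sup>2)"
    by (rule integral_mono[OF sq_Re sq]) (simp add: cmod_power2)
  finally show ?thesis
    using int by simp
qed

lemma ln_minus_plus_fraction_le:
  fixes w \<gamma> :: real
  assumes "w \<ge> 0" "\<gamma> \<ge> 0"
  shows "ln (1 + w) - w + (1 + w) * (\<gamma> / (1 + \<gamma>)) \<le> ln (1 + \<gamma>)"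
proof -
  \<comment> \<open>Since \<open>w - (1 + w) * (\<gamma> / (1 + \<gamma>)) = (1 + w) / (1 +
    \<gamma>) - 1\<close>, this is the claim rearranged.\<close>
  have "ln ((1 + w) / (1 + \<gamma>)) \<le> (1 + w) / (1 + \<gamma>) - 1"
    using assms by (intro ln_le_minus_one) simp
  then show ?thesis
    using assms by (simp add: ln_div field_simps)
qed

text \<open>Multiplied by \<open>t\<close>, the gap is \<open>(a - v * t)\<^sup>2\<close>. It
  vanishes at \<open>v = a / t\<close>, the form of the algorithm's update of
  \<open>v\<close>.\<close>

lemma quadratic_transform_le:
  fixes a t v :: real
  assumes "t > 0"
  shows "2 * v * a - v\<^sup>2 * t \<le> a\<^sup>2 / t"
proof -
  have "(2 * v * a - v\<^sup>2 * t) * t \<le> a\<^sup>2"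
    using zero_le_power2[of "a - v * t"] by (simp add: power2_eq_square algebra_simps)
  with assms show ?thesis
    by (simp add: pos_le_divide_eq)
qed

section \<open>Quadratic forms as second moments of the received signal\<close>

context downlink_system
begin

abbreviation "SINR \<kappa>' n \<equiv> Gain \<kappa>' n / Interf \<kappa>' n"

text \<open>The effective channel coefficient with which the symbol meant for user \<open>q\<close>
  reaches user \<open>n\<close>, superposed over all APs.\<close>

definition signal :: "('a \<Rightarrow> 'u \<Rightarrow> real) \<Rightarrow> 'u \<Rightarrow> 'u \<Rightarrow> 'w \<Rightarrow> complex" where
  "signal \<kappa> n q \<omega> = (\<Sum>j\<in>A. of_real (\<kappa> j q) * dotT (f j n \<omega>) (p j q \<omega>))"

lemma dotT_measurable:
  "j \<in> A \<Longrightarrow> n \<in> U \<Longrightarrow> q \<in> U \<Longrightarrow> (\<lambda>\<omega>. dotT (f j n \<omega>) (p j q \<omega>)) \<in> borel_measurable M"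
  by (intro dotT_borel_measurable f_measurable p_measurable)

lemma signal_measurable:
  "n \<in> U \<Longrightarrow> q \<in> U \<Longrightarrow> signal \<kappa> n q \<in> borel_measurable M"
  unfolding signal_def
  by (intro borel_measurable_sum borel_measurable_times borel_measurable_const dotT_measurable)

text \<open>The squared modulus expands into a double sum over pairs of APs; each term is
  integrable, and the expectations of its products are the entries of \<open>Imat\<close>.\<close>

lemma signal_second_moment:
  assumes "n \<in> U" "q \<in> U"
  shows "integrable M (\<lambda>\<omega>. (cmod (signal \<kappa> n q \<omega>))\<^sup>2)"
    and "quad \<kappa> n q = (\<integral>\<omega>. (cmod (signal \<kappa> n q \<omega>))\<^sup>2 \<partial>M)"
proof -
  let ?X = "\<lambda>j \<omega>. dotT (f j n \<omega>) (p j q \<omega>)"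
  let ?t = "\<lambda>j j' \<omega>. of_real (\<kappa> j q) * (?X j \<omega> * cnj (?X j' \<omega>)) * of_real (\<kappa> j' q)"
  have int: "integrable M (\<lambda>\<omega>. ?X j \<omega> * cnj (?X j' \<omega>))" if "j \<in> A" "j' \<in> A" for j j'
    using that assms by (intro integrable_mult_cnj dotT_measurable square_integrable)
  have expand: "of_real ((cmod (signal \<kappa> n q \<omega>))\<^sup>2) = (\<Sum>j\<in>A. \<Sum>j'\<in>A. ?t j j' \<omega>)" for \<omega>
    unfolding complex_norm_square signal_def
    by (simp add: sum_product algebra_simps)
  have int_sum: "integrable M (\<lambda>\<omega>. \<Sum>j\<in>A. \<Sum>j'\<in>A. ?t j j' \<omega>)"
    using int by (intro Bochner_Integration.integrable_sum integrable_mult_left integrable_mult_right)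
  \<comment> \<open>The double sum is complex-valued; taking real parts carries its integrability
    and its integral over to the real integrand.\<close>
  have Re_expand: "(cmod (signal \<kappa> n q \<omega>))\<^sup>2 = Re (\<Sum>j\<in>A. \<Sum>j'\<in>A. ?t j j' \<omega>)" for \<omega>
    by (metis expand Re_complex_of_real)
  show "integrable M (\<lambda>\<omega>. (cmod (signal \<kappa> n q \<omega>))\<^sup>2)"
    unfolding Re_expand by (rule integrable_Re[OF int_sum])
  have "(\<integral>\<omega>. (\<Sum>j\<in>A. \<Sum>j'\<in>A. ?t j j' \<omega>) \<partial>M)
      = (\<Sum>j\<in>A. \<Sum>j'\<in>A. of_real (\<kappa> j q) * Imat n q j j' * of_real (\<kappa> j' q))"
    unfolding Imat_def dotT_cnj_vec using int
    by (simp add: Bochner_Integration.integral_sum)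
  then show "quad \<kappa> n q = (\<integral>\<omega>. (cmod (signal \<kappa> n q \<omega>))\<^sup>2 \<partial>M)"
    unfolding Re_expand quad_def using integral_Re[OF int_sum] by simp
qed

lemma quad_nonneg: "n \<in> U \<Longrightarrow> q \<in> U \<Longrightarrow> 0 \<le> quad \<kappa> n q"
  by (simp add: signal_second_moment(2))

lemma lin_eq_mean_signal:
  assumes "n \<in> U"
  shows "lin \<kappa> n = Re (\<integral>\<omega>. signal \<kappa> n n \<omega> \<partial>M)"
proof -
  have "integrable M (\<lambda>\<omega>. dotT (f j n \<omega>) (p j n \<omega>))" if "j \<in> A" for j
    using integrable_mult_cnj[OF dotT_measurable _ square_integrable, of j n n "\<lambda>_. 1"] that assms
    by simp
  then show ?thesis
    unfolding lin_def gvec_def signal_def by (simp add: Bochner_Integration.integral_sum)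
qed

text \<open>A squared mean is at most the second moment. This controls the term subtracted in
  \<open>Interf\<close>.\<close>

lemma lin_square_le_quad: "n \<in> U \<Longrightarrow> (lin \<kappa> n)\<^sup>2 \<le> quad \<kappa> n n"
  by (simp add: lin_eq_mean_signal signal_second_moment mean_Re_square_le signal_measurable)

section \<open>Positivity of interference and total power\<close>

lemma Gain_nonneg: "0 \<le> Gain \<kappa> n"
  by (simp add: Gain_def)

lemma noise_pos: "n \<in> U \<Longrightarrow> 0 < 1 / Ed * s2 n"
  using Ed_pos s2_pos by simp

text \<open>The summand \<open>q = n\<close> alone absorbs the subtracted square, and the others are
  nonnegative. The lower bound is uniform in \<open>\<kappa>\<close>, as \<open>SINR_le\<close>
  requires.\<close>

lemma noise_le_Interf:
  assumes "n \<in> U"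
  shows "1 / Ed * s2 n \<le> Interf \<kappa> n"
proof -
  have "quad \<kappa> n n \<le> (\<Sum>q\<in>U. quad \<kappa> n q)"
    using assms finite_U quad_nonneg by (intro member_le_sum) auto
  with lin_square_le_quad[OF assms, of \<kappa>] show ?thesis
    unfolding Interf_def by linarith
qed

lemma Interf_pos: "n \<in> U \<Longrightarrow> 0 < Interf \<kappa> n"
  using noise_pos noise_le_Interf by (rule less_le_trans)

lemma Gain_plus_Interf: "Gain \<kappa> n + Interf \<kappa> n = total_power \<kappa> n"
  by (simp add: Gain_def Interf_def total_power_def)

lemma total_power_pos: "n \<in> U \<Longrightarrow> 0 < total_power \<kappa> n"
  by (metis Gain_plus_Interf Gain_nonneg Interf_pos add_nonneg_pos)

lemma SINR_nonneg: "n \<in> U \<Longrightarrow> 0 \<le> SINR \<kappa> n"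
  by (simp add: Gain_nonneg Interf_pos less_imp_le)

section \<open>The objective as a function of \<open>w\<close>\<close>

lemma Gain_fraction_eq:
  "n \<in> U \<Longrightarrow> Gain \<kappa> n / (Gain \<kappa> n + Interf \<kappa> n) = SINR \<kappa> n / (1 + SINR \<kappa> n)"
  using Interf_pos[of n \<kappa>] by (simp add: field_simps)

lemma objective_eq_sum:
  "objective \<kappa> w =
     (\<Sum>n\<in>U. ln (1 + w n) - w n + (1 + w n) * (SINR \<kappa> n / (1 + SINR \<kappa> n)))"
  unfolding objective_def
  by (simp add: sum.distrib sum_subtractf Gain_fraction_eq flip: times_divide_eq_right)

lemma objective_le_rate:
  assumes "\<forall>n\<in>U. w n \<ge> 0"
  shows "objective \<kappa> w \<le> (\<Sum>n\<in>U. ln (1 + SINR \<kappa> n))"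
  unfolding objective_eq_sum
  using assms by (intro sum_mono ln_minus_plus_fraction_le SINR_nonneg) auto

lemma objective_at_SINR:
  assumes "\<forall>n\<in>U. w n = SINR \<kappa> n"
  shows "objective \<kappa> w = (\<Sum>n\<in>U. ln (1 + SINR \<kappa> n))"
  unfolding objective_eq_sum
proof (rule sum.cong)
  fix n assume "n \<in> U"
  \<comment> \<open>Cancelling this nonzero factor turns the fractional term into
    \<open>SINR \<kappa> n\<close>, which offsets \<open>- w n\<close>.\<close>
  then have "1 + SINR \<kappa> n \<noteq> 0" "w n = SINR \<kappa> n"
    using SINR_nonneg[of n \<kappa>] assms by (linarith, blast)
  then show "ln (1 + w n) - w n + (1 + w n) * (SINR \<kappa> n / (1 + SINR \<kappa> n)) = ln (1 + SINR \<kappa> n)"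
    by simp
qed simp

section \<open>Boundedness over the feasible set\<close>

lemma feasible_abs_le_one:
  assumes "feasible \<kappa>" "j \<in> A" "n \<in> U"
  shows "\<bar>\<kappa> j n\<bar> \<le> 1"
proof -
  have "(\<kappa> j n)\<^sup>2 \<le> (\<Sum>q\<in>U. (\<kappa> j q)\<^sup>2)"
    using assms finite_U by (intro member_le_sum) auto
  also have "\<dots> \<le> 1"
    using assms by (simp add: feasible_def)
  finally show ?thesis
    by (simp add: abs_square_le_1)
qed

text \<open>Feasible coefficients have modulus at most 1, which bounds the numerator; the noise
  bounds the denominator from below.\<close>

lemma SINR_le:
  assumes "feasible \<kappa>" "n \<in> U"
  shows "SINR \<kappa> n \<le> (\<Sum>j\<in>A. \<bar>gvec n j\<bar>)\<^sup>2 / (1 / Ed * s2 n)"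
proof -
  have "\<bar>lin \<kappa> n\<bar> \<le> (\<Sum>j\<in>A. \<bar>\<kappa> j n * gvec n j\<bar>)"
    unfolding lin_def by (rule sum_abs)
  also have "\<dots> \<le> (\<Sum>j\<in>A. \<bar>gvec n j\<bar>)"
    using assms by (intro sum_mono) (simp add: abs_mult feasible_abs_le_one mult_left_le_one_le)
  finally have "Gain \<kappa> n \<le> (\<Sum>j\<in>A. \<bar>gvec n j\<bar>)\<^sup>2"
    unfolding Gain_def by (subst power2_abs[symmetric]) (rule power_mono, simp_all)
  then show ?thesis
    using assms noise_pos noise_le_Interf by (intro frac_le) auto
qed

text \<open>Maximising over \<open>w\<close> first removes the unbounded variable;
  \<open>ln (1 + x) \<le> x\<close> and \<open>SINR_le\<close> then give an explicit
  constant.\<close>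

lemma objective_bdd_above:
  "bdd_above {objective \<kappa> w | \<kappa> w. feasible \<kappa> \<and> (\<forall>n\<in>U. w n \<ge> 0)}"
proof (rule bdd_aboveI, safe)
  fix \<kappa> and w :: "'u \<Rightarrow> real"
  assume *: "feasible \<kappa>" "\<forall>n\<in>U. w n \<ge> 0"
  have "objective \<kappa> w \<le> (\<Sum>n\<in>U. ln (1 + SINR \<kappa> n))"
    using * by (intro objective_le_rate)
  also have "\<dots> \<le> (\<Sum>n\<in>U. SINR \<kappa> n)"
    by (intro sum_mono ln_add_one_self_le_self SINR_nonneg)
  also have "\<dots> \<le> (\<Sum>n\<in>U. (\<Sum>j\<in>A. \<bar>gvec n j\<bar>)\<^sup>2 / (1 / Ed * s2 n))"
    using * by (intro sum_mono SINR_le)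
  finally show "objective \<kappa> w \<le> (\<Sum>n\<in>U. (\<Sum>j\<in>A. \<bar>gvec n j\<bar>)\<^sup>2 / (1 / Ed * s2 n))" .
qed

section \<open>The quadratic surrogate\<close>

text \<open>The factor \<open>1 + w n\<close> is absorbed into the square, so that
  \<open>quadratic_transform_le\<close> applies with
  \<open>a = sqrt (1 + w n) * lin \<kappa> n\<close>.\<close>

lemma objective_eq_fractions:
  assumes "\<forall>n\<in>U. w n \<ge> 0"
  shows "objective \<kappa> w = (\<Sum>n\<in>U. ln (1 + w n)) - (\<Sum>n\<in>U. w n)
           + (\<Sum>n\<in>U. (sqrt (1 + w n) * lin \<kappa> n)\<^sup>2 / total_power \<kappa> n)"
  unfolding objective_def Gain_plus_Interf using assms
  by (auto intro!: sum.cong simp: Gain_def power_mult_distrib)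

lemma qcqp_objective_le:
  "qcqp_objective w v \<kappa> \<le> (\<Sum>n\<in>U. (sqrt (1 + w n) * lin \<kappa> n)\<^sup>2 / total_power \<kappa> n)"
  unfolding qcqp_objective_def
proof (rule sum_mono)
  fix n assume "n \<in> U"
  from quadratic_transform_le[OF total_power_pos[OF this], of "v n" "sqrt (1 + w n) * lin \<kappa> n" \<kappa>]
  show "2 * v n * sqrt (1 + w n) * lin \<kappa> n - (v n)\<^sup>2 * total_power \<kappa> n
      \<le> (sqrt (1 + w n) * lin \<kappa> n)\<^sup>2 / total_power \<kappa> n"
    by (simp add: mult.assoc)
qed

lemma qcqp_objective_tight:
  assumes "\<forall>n\<in>U. v n = sqrt (1 + w n) * lin \<kappa> n / total_power \<kappa> n"
  shows "qcqp_objective w v \<kappa> = (\<Sum>n\<in>U. (sqrt (1 + w n) * lin \<kappa> n)\<^sup>2 / total_power \<kappa> n)"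
  unfolding qcqp_objective_def
proof (rule sum.cong)
  fix n assume "n \<in> U"
  then have "v n = sqrt (1 + w n) * lin \<kappa> n / total_power \<kappa> n" "total_power \<kappa> n \<noteq> 0"
    using assms total_power_pos[of n \<kappa>] by auto
  then show "2 * v n * sqrt (1 + w n) * lin \<kappa> n - (v n)\<^sup>2 * total_power \<kappa> n
      = (sqrt (1 + w n) * lin \<kappa> n)\<^sup>2 / total_power \<kappa> n"
    by (simp add: power2_eq_square field_simps)
qed simp

section \<open>Monotonicity and convergence along a run\<close>

lemma algorithm_run_nonneg:
  "algorithm_run \<kappa> w v \<Longrightarrow> n \<in> U \<Longrightarrow> 0 \<le> w (Suc i) n"
  by (simp add: algorithm_run_def SINR_nonneg del: zero_le_divide_iff)

lemma algorithm_run_feasible: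
  "algorithm_run \<kappa> w v \<Longrightarrow> feasible (\<kappa> (Suc i))"
  by (simp add: algorithm_run_def is_arg_max_def)

text \<open>The update of \<open>w\<close> does not decrease the objective at fixed
  \<open>\<kappa>\<close>, and the update of \<open>\<kappa>\<close> does not at fixed
  \<open>w\<close>. Since \<open>w 0\<close> is arbitrary, nonnegativity of \<open>w i\<close> is a
  hypothesis.\<close>

lemma algorithm_run_step:
  assumes run: "algorithm_run \<kappa> w v" and w: "\<forall>n\<in>U. w i n \<ge> 0" and feas: "feasible (\<kappa> i)"
  shows "objective (\<kappa> i) (w i) \<le> objective (\<kappa> (Suc i)) (w (Suc i))"
proof -
  let ?Q = "qcqp_objective (w (Suc i)) (v (Suc i))"
  let ?F = "\<lambda>\<kappa>. \<Sum>n\<in>U. (sqrt (1 + w (Suc i) n) * lin \<kappa> n)\<^sup>2 / total_power \<kappa> n"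
  have w': "\<forall>n\<in>U. w (Suc i) n \<ge> 0"
    using algorithm_run_nonneg[OF run] by blast
  have "objective (\<kappa> i) (w i) \<le> objective (\<kappa> i) (w (Suc i))"
    using objective_le_rate[OF w] objective_at_SINR[of "w (Suc i)" "\<kappa> i"] run
    by (simp add: algorithm_run_def)
  moreover have "?F (\<kappa> i) = ?Q (\<kappa> i)"
    using run by (intro qcqp_objective_tight[symmetric]) (simp add: algorithm_run_def)
  \<comment> \<open>The current iterate is feasible, hence a competitor in the quadratic
    program.\<close>
  moreover have "?Q (\<kappa> i) \<le> ?Q (\<kappa> (Suc i))"
    using run feas by (auto simp: algorithm_run_def is_arg_max_def not_less)
  moreover have "?Q (\<kappa> (Suc i)) \<le> ?F (\<kappa> (Suc i))"
    by (rule qcqp_objective_le)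
  \<comment> \<open>At fixed \<open>w (Suc i)\<close>, the objective and \<open>?F\<close> differ by
    a quantity independent of \<open>\<kappa>\<close>.\<close>
  ultimately show ?thesis
    unfolding objective_eq_fractions[OF w'] by linarith
qed

lemma algorithm_run_mono:
  "algorithm_run \<kappa> w v \<Longrightarrow>
     objective (\<kappa> (Suc i)) (w (Suc i)) \<le> objective (\<kappa> (Suc (Suc i))) (w (Suc (Suc i)))"
  by (simp add: algorithm_run_step algorithm_run_nonneg algorithm_run_feasible)

lemma algorithm_run_convergent:
  assumes run: "algorithm_run \<kappa> w v"
  shows "convergent (\<lambda>i. objective (\<kappa> i) (w i))"
proof -
  obtain B where B: "\<And>\<kappa> w. feasible \<kappa> \<Longrightarrow> \<forall>n\<in>U. w n \<ge> 0 \<Longrightarrow> objective \<kappa> w \<le> B"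
    using objective_bdd_above unfolding bdd_above_def by blast
  \<comment> \<open>The shift skips index 0, where \<open>w 0\<close> is arbitrary; the limit is
    unaffected by this one term.\<close>
  have "incseq (\<lambda>i. objective (\<kappa> (Suc i)) (w (Suc i)))"
    using algorithm_run_mono[OF run] by (rule incseq_SucI)
  moreover have "\<forall>i. objective (\<kappa> (Suc i)) (w (Suc i)) \<le> B"
    using algorithm_run_feasible[OF run] algorithm_run_nonneg[OF run] B by blast
  ultimately obtain L where "(\<lambda>i. objective (\<kappa> (Suc i)) (w (Suc i))) \<longlonglongrightarrow> L"
    by (rule incseq_convergent)
  then show ?thesis
    unfolding convergent_def by (blast intro: LIMSEQ_imp_Suc)
qed

end

theorem proposition4:
  fixes M :: "'w measure" and A :: "'a set" and U :: "'u set"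
    and f p :: "'a \<Rightarrow> 'u \<Rightarrow> 'w \<Rightarrow> complex ^ 'm::finite"
    and Ed :: real and s2 :: "'u \<Rightarrow> real"
    and \<kappa> :: "nat \<Rightarrow> 'a \<Rightarrow> 'u \<Rightarrow> real" and w v :: "nat \<Rightarrow> 'u \<Rightarrow> real"
  assumes "downlink_system M A U f p Ed s2"
    and "downlink_system.algorithm_run M A U f p Ed s2 \<kappa> w v"
  shows "bdd_above {downlink_system.objective M A U f p Ed s2 \<kappa>' w' | \<kappa>' w'.
            downlink_system.feasible A U \<kappa>' \<and> (\<forall>n\<in>U. w' n \<ge> 0)}
    \<and> (\<forall>i\<ge>1. downlink_system.objective M A U f p Ed s2 (\<kappa> (Suc i)) (w (Suc i))
               \<ge> downlink_system.objective M A U f p Ed s2 (\<kappa> i) (w i))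
    \<and> convergent (\<lambda>i. downlink_system.objective M A U f p Ed s2 (\<kappa> i) (w i))"
proof -
  interpret downlink_system M A U f p Ed s2
    by fact
  \<comment> \<open>An index \<open>i \<ge> 1\<close> is a successor, which matches the shifted form
    of \<open>algorithm_run_mono\<close>.\<close>
  show ?thesis
    using objective_bdd_above algorithm_run_mono[OF assms(2)] algorithm_run_convergent[OF assms(2)]
    by (auto simp: Suc_le_eq gr0_conv_Suc)
qed

end
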